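(* Let $n\ge 1$, and let $Y_1,\dots,Y_n$ with $r$-dimensional covariates be observed from a ULARMA$(p,q)$ model with parameter vector $\boldsymbol\gamma=(\alpha,\boldsymbol\beta',\boldsymbol\phi',\boldsymbol\theta')'\in\Omega\subset\mathbb{R}^{r+p+q+1}$ (as defined in the context). Let $K_n(\boldsymbol\gamma)$ be the conditional information matrix $$K_n(\boldsymbol\gamma):=-\sum_{t=1}^n \mathbb{E}\left(\frac{\partial^2\ell_t(\boldsymbol\gamma)}{\partial\boldsymbol\gamma\,\partial\boldsymbol\gamma'}\,\Big|\,\mathcal{F}_{t-1}\right),$$ where the expectation is taken under the model with the same parameter $\boldsymbol\gamma$, i.e. $Y_t\mid\mathcal{F}_{t-1}\sim\mathrm{UL}(\mu_t)$ with $\mu_t=\mu_t(\boldsymbol\gamma)$. Let $D$ be the $n\times(p+q+r+1)$ matrix with entries $[D]_{i,j}=\partial\eta_i/\partial\gamma_j$, let $T=\mathrm{diag}\{1/g'(\mu_1),\dots,1/g'(\mu_n)\}$, and let $E_\mu$ be the $n\times n$ diagonal matrix with diagonal entries $$[E_\mu]_{k,k}=\frac{2-(1-\mu_k)^2}{\mu_k^2(1-\mu_k)^2},\qquad k=1,\dots,n.$$ Then $[E_\mu]_{k,k}=-\mathbb{E}\left(\frac{\partial^2\ell_k(\boldsymbol\gamma)}{\partial\mu_k^2}\,\big|\,\mathcal{F}_{k-1}\right)$ for every $k$, and $$K_n(\boldsymbol\gamma)=D'\,T\,E_\mu\,T\,D .$$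
   Context: Unit-Lindley distribution: for $\mu\in(0,1)$, $\mathrm{UL}(\mu)$ is the distribution on $(0,1)$ with density $$f(y;\mu)=\frac{(1-\mu)^2}{\mu(1-y)^3}\exp\left\{\frac{y(\mu-1)}{\mu(1-y)}\right\},\quad 0<y<1.$$ ULARMA$(p,q)$ model: $\{Y_t\}$ is a $(0,1)$-valued process, $\{\boldsymbol X_t\}$ an $\mathbb{R}^r$-valued sequence of covariates (random or deterministic), $\mathcal{F}_t=\sigma\{\boldsymbol X_{t+1},Y_t,\boldsymbol X_t,Y_{t-1},\dots\}$. The link $g:(0,1)\to\mathbb{R}$ is a twice differentiable bijection with $g'\neq0$ everywhere. The parameters are $\alpha\in\mathbb{R}$, $\boldsymbol\beta\in\mathbb{R}^r$, $\boldsymbol\phi=(\phi_1,\dots,\phi_p)'$, $\boldsymbol\theta=(\theta_1,\dots,\theta_q)'$. Conditionally, $Y_t\mid\mathcal{F}_{t-1}\sim\mathrm{UL}(\mu_t)$, where for $t\ge1$ $$\eta_t=g(\mu_t)=\alpha+\boldsymbol X_t'\boldsymbol\beta+\sum_{i=1}^p\phi_i\big[g(Y_{t-i})-\boldsymbol X_{t-i}'\boldsymbol\beta\big]+\sum_{j=1}^q\theta_j r_{t-j},\qquad r_t=g(Y_t)-g(\mu_t).$$ Initialization: the pre-sample values $Y_t,\boldsymbol X_t$ ($t\le0$) are treated as given, $\mathcal{F}_0$-measurable and not depending on $\boldsymbol\gamma$, and $r_t=0$ for $t\le0$. Thus $\eta_t$ and $\mu_t=g^{-1}(\eta_t)$ are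 $\mathcal{F}_{t-1}$-measurable functions of $\boldsymbol\gamma$ for $t\ge1$. The partial log-likelihood terms are $$\ell_t(\boldsymbol\gamma)=2\ln(1-\mu_t)-\ln(\mu_t)-3\ln(1-Y_t)+\frac{Y_t(\mu_t-1)}{\mu_t(1-Y_t)},\qquad 1\le t\le n,$$ and $\partial\ell_t/\partial\mu_t$, $\partial^2\ell_t/\partial\mu_t^2$ denote derivatives of this expression in $\mu_t$ with $Y_t$ held fixed. Conditional expectations given $\mathcal{F}_{t-1}$ are integrals against the conditional law $\mathrm{UL}(\mu_t)$ of $Y_t$, with $\mathcal{F}_{t-1}$-measurable quantities held fixed. A prime on a vector or matrix denotes transpose; $g'$ denotes the derivative of $g$. *)

theory Defs
  imports "HOL-Probability.Probability" "Jordan_Normal_Form.Matrix"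
begin

unbundle no vec_syntax

hide_const (open) Finite_Cartesian_Product.vec Finite_Cartesian_Product.mat

section \<open>The unit-Lindley distribution\<close>

definition UL_density :: "real \<Rightarrow> real \<Rightarrow> real" where
  "UL_density \<mu> y =
     (1 - \<mu>)\<^sup>2 / (\<mu> * (1 - y) ^ 3) * exp (y * (\<mu> - 1) / (\<mu> * (1 - y)))"

definition UL :: "real \<Rightarrow> real measure" where
  "UL \<mu> = density lborel (\<lambda>y. ennreal (UL_density \<mu> y * indicator {0<..<1} y))"

definition UL_loglik :: "real \<Rightarrow> real \<Rightarrow> real" where
  "UL_loglik \<mu> y =
     2 * ln (1 - \<mu>) - ln \<mu> - 3 * ln (1 - y) + y * (\<mu> - 1) / (\<mu> * (1 - y))"

section \<open>Link function and parameter vector\<close>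

definition link_function :: "(real \<Rightarrow> real) \<Rightarrow> bool" where
  "link_function g \<longleftrightarrow>
     bij_betw g {0<..<1} UNIV \<and>
     g differentiable_on {0<..<1} \<and>
     deriv g differentiable_on {0<..<1} \<and>
     (\<forall>m\<in>{0<..<1}. deriv g m \<noteq> 0)"

abbreviation inv_link :: "(real \<Rightarrow> real) \<Rightarrow> real \<Rightarrow> real" where
  "inv_link g \<equiv> inv_into {0<..<1} g"

text \<open>
  The parameter vector \<open>\<gamma> = (\<alpha>, \<beta>', \<phi>', \<theta>')'\<close> is a vector of dimension
  \<open>1 + r + p + q\<close>, indexed from 0. The coefficients \<open>\<phi>\<^sub>i\<close> and \<open>\<theta>\<^sub>j\<close> keep their
  indices \<open>i = 1, \<dots>, p\<close> and \<open>j = 1, \<dots>, q\<close>.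
\<close>

definition par_alpha :: "real vec \<Rightarrow> real" where
  "par_alpha \<gamma> = \<gamma> $ 0"

definition par_beta :: "nat \<Rightarrow> real vec \<Rightarrow> real vec" where
  "par_beta r \<gamma> = vec r (\<lambda>k. \<gamma> $ (1 + k))"

definition par_phi :: "nat \<Rightarrow> real vec \<Rightarrow> nat \<Rightarrow> real" where
  "par_phi r \<gamma> i = \<gamma> $ (1 + r + (i - 1))"

definition par_theta :: "nat \<Rightarrow> nat \<Rightarrow> real vec \<Rightarrow> nat \<Rightarrow> real" where
  "par_theta r p \<gamma> j = \<gamma> $ (1 + r + p + (j - 1))"

section \<open>The ULARMA(p,q) model\<close>

text \<open>
  \<open>eta \<dots> \<gamma> t \<omega>\<close> is the linear predictor at time \<open>t \<ge> 1\<close>; its value at \<open>t = 0\<close> is irrelevant.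
  The summand for \<open>\<theta>\<^sub>j\<close> contains \<open>r\<^sub>t\<^sub>-\<^sub>j = g(Y\<^sub>t\<^sub>-\<^sub>j) - g(\<mu>\<^sub>t\<^sub>-\<^sub>j)\<close> if \<open>t - j \<ge> 1\<close>, and 0 otherwise.
\<close>

fun eta :: "(real \<Rightarrow> real) \<Rightarrow> nat \<Rightarrow> nat \<Rightarrow> nat \<Rightarrow> (int \<Rightarrow> 'a \<Rightarrow> real vec) \<Rightarrow>
    (int \<Rightarrow> 'a \<Rightarrow> real) \<Rightarrow> real vec \<Rightarrow> nat \<Rightarrow> 'a \<Rightarrow> real" where
  "eta g r p q X Y \<gamma> t \<omega> =
     par_alpha \<gamma> + X (int t) \<omega> \<bullet> par_beta r \<gamma>
     + (\<Sum>i = 1..p. par_phi r \<gamma> i *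
          (g (Y (int t - int i) \<omega>) - X (int t - int i) \<omega> \<bullet> par_beta r \<gamma>))
     + (\<Sum>j = 1..q. par_theta r p \<gamma> j *
          (if 1 \<le> j \<and> j < t
           then g (Y (int t - int j) \<omega>) - g (inv_link g (eta g r p q X Y \<gamma> (t - j) \<omega>))
           else 0))"

declare eta.simps [simp del]

definition mu :: "(real \<Rightarrow> real) \<Rightarrow> nat \<Rightarrow> nat \<Rightarrow> nat \<Rightarrow> (int \<Rightarrow> 'a \<Rightarrow> real vec) \<Rightarrow>
    (int \<Rightarrow> 'a \<Rightarrow> real) \<Rightarrow> real vec \<Rightarrow> nat \<Rightarrow> 'a \<Rightarrow> real" where
  "mu g r p q X Y \<gamma> t \<omega> = inv_link g (eta g r p q X Y \<gamma> t \<omega>)"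

text \<open>\<open>past M r X Y t\<close> is \<open>\<sigma>{X\<^sub>t\<^sub>+\<^sub>1, Y\<^sub>t, X\<^sub>t, Y\<^sub>t\<^sub>-\<^sub>1, \<dots>}\<close> as a measurable space.\<close>

definition past :: "'a measure \<Rightarrow> nat \<Rightarrow> (int \<Rightarrow> 'a \<Rightarrow> real vec) \<Rightarrow> (int \<Rightarrow> 'a \<Rightarrow> real) \<Rightarrow>
    int \<Rightarrow> 'a measure" where
  "past M r X Y t = sigma (space M)
     ({(\<lambda>\<omega>. X s \<omega> $ k) -` A \<inter> space M | s k A. s \<le> t + 1 \<and> k < r \<and> A \<in> sets borel} \<union>
      {Y s -` A \<inter> space M | s A. s \<le> t \<and> A \<in> sets borel})"

locale ularma = prob_space M for M :: "'a measure" +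
  fixes g :: "real \<Rightarrow> real" and r p q :: nat
    and X :: "int \<Rightarrow> 'a \<Rightarrow> real vec" and Y :: "int \<Rightarrow> 'a \<Rightarrow> real"
    and \<gamma> :: "real vec"
  assumes link: "link_function g"
    and par_dim: "\<gamma> \<in> carrier_vec (1 + r + p + q)"
    and X_dim: "\<And>t \<omega>. \<omega> \<in> space M \<Longrightarrow> X t \<omega> \<in> carrier_vec r"
    and X_meas: "\<And>t k. k < r \<Longrightarrow> (\<lambda>\<omega>. X t \<omega> $ k) \<in> borel_measurable M"
    and Y_range: "\<And>t \<omega>. \<omega> \<in> space M \<Longrightarrow> Y t \<omega> \<in> {0<..<1}"
    and Y_meas: "\<And>t. Y t \<in> borel_measurable M"
    and cond_law: "\<And>t A. 1 \<le> t \<Longrightarrow> A \<in> sets borel \<Longrightarrow>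
      AE \<omega> in M. real_cond_exp M (past M r X Y (int t - 1)) (\<lambda>\<omega>. indicator A (Y (int t) \<omega>)) \<omega>
        = measure (UL (mu g r p q X Y \<gamma> t \<omega>)) A"

section \<open>Conditional information matrix\<close>

text \<open>
  Quantities depending on the past and on \<open>Y\<^sub>t\<close> are written as \<open>h \<omega> y\<close>, where \<open>y\<close> is the
  slot for the value of \<open>Y\<^sub>t\<close>. Their conditional expectation given the past up to time
  \<open>t - 1\<close> is either the integral against the conditional law of \<open>Y\<^sub>t\<close> (\<open>law_cond_exp\<close>, defined
  at every \<open>\<omega>\<close>) or the abstract conditional expectation of \<open>\<omega> \<mapsto> h \<omega> (Y\<^sub>t \<omega>)\<close>
  (\<open>abs_cond_exp\<close>, determined almost surely).
\<close>

definition law_cond_exp :: "(real \<Rightarrow> real) \<Rightarrow> nat \<Rightarrow> nat \<Rightarrow> nat \<Rightarrow> (int \<Rightarrow> 'a \<Rightarrow> real vec) \<Rightarrow>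
    (int \<Rightarrow> 'a \<Rightarrow> real) \<Rightarrow> real vec \<Rightarrow> nat \<Rightarrow> ('a \<Rightarrow> real \<Rightarrow> real) \<Rightarrow> 'a \<Rightarrow> real" where
  "law_cond_exp g r p q X Y \<gamma> t h \<omega> = (\<integral>y. h \<omega> y \<partial>UL (mu g r p q X Y \<gamma> t \<omega>))"

definition abs_cond_exp :: "'a measure \<Rightarrow> nat \<Rightarrow> (int \<Rightarrow> 'a \<Rightarrow> real vec) \<Rightarrow>
    (int \<Rightarrow> 'a \<Rightarrow> real) \<Rightarrow> nat \<Rightarrow> ('a \<Rightarrow> real \<Rightarrow> real) \<Rightarrow> 'a \<Rightarrow> real" where
  "abs_cond_exp M r X Y t h =
     real_cond_exp M (past M r X Y (int t - 1)) (\<lambda>\<omega>. h \<omega> (Y (int t) \<omega>))"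

definition partial_deriv :: "nat \<Rightarrow> (real vec \<Rightarrow> real) \<Rightarrow> real vec \<Rightarrow> real" where
  "partial_deriv j f \<gamma> = deriv (\<lambda>s. f (\<gamma> + s \<cdot>\<^sub>v unit_vec (dim_vec \<gamma>) j)) 0"

text \<open>The term \<open>\<ell>\<^sub>t(\<gamma>)\<close> is \<open>loglik_term \<dots> \<gamma> t \<omega> (Y\<^sub>t \<omega>)\<close>.\<close>

definition loglik_term :: "(real \<Rightarrow> real) \<Rightarrow> nat \<Rightarrow> nat \<Rightarrow> nat \<Rightarrow> (int \<Rightarrow> 'a \<Rightarrow> real vec) \<Rightarrow>
    (int \<Rightarrow> 'a \<Rightarrow> real) \<Rightarrow> real vec \<Rightarrow> nat \<Rightarrow> 'a \<Rightarrow> real \<Rightarrow> real" where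
  "loglik_term g r p q X Y \<gamma> t \<omega> y = UL_loglik (mu g r p q X Y \<gamma> t \<omega>) y"

text \<open>\<open>E t h \<omega>\<close> is the conditional expectation of \<open>h\<close> given the past up to time \<open>t - 1\<close>.\<close>

definition cond_info_matrix :: "(nat \<Rightarrow> ('a \<Rightarrow> real \<Rightarrow> real) \<Rightarrow> 'a \<Rightarrow> real) \<Rightarrow>
    (real \<Rightarrow> real) \<Rightarrow> nat \<Rightarrow> nat \<Rightarrow> nat \<Rightarrow> (int \<Rightarrow> 'a \<Rightarrow> real vec) \<Rightarrow>
    (int \<Rightarrow> 'a \<Rightarrow> real) \<Rightarrow> real vec \<Rightarrow> nat \<Rightarrow> 'a \<Rightarrow> real mat" where
  "cond_info_matrix E g r p q X Y \<gamma> n \<omega> =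
     mat (1 + r + p + q) (1 + r + p + q) (\<lambda>(i, j).
       - (\<Sum>t = 1..n. E t (\<lambda>\<omega> y.
            partial_deriv i (partial_deriv j (\<lambda>\<gamma>. loglik_term g r p q X Y \<gamma> t \<omega> y)) \<gamma>) \<omega>))"

text \<open>Row \<open>i\<close> of the following matrices (counted from 0) belongs to time \<open>i + 1\<close>.\<close>

definition D_matrix :: "(real \<Rightarrow> real) \<Rightarrow> nat \<Rightarrow> nat \<Rightarrow> nat \<Rightarrow> (int \<Rightarrow> 'a \<Rightarrow> real vec) \<Rightarrow>
    (int \<Rightarrow> 'a \<Rightarrow> real) \<Rightarrow> real vec \<Rightarrow> nat \<Rightarrow> 'a \<Rightarrow> real mat" where
  "D_matrix g r p q X Y \<gamma> n \<omega> =
     mat n (1 + r + p + q) (\<lambda>(i, j). partial_deriv j (\<lambda>\<gamma>. eta g r p q X Y \<gamma> (Suc i) \<omega>) \<gamma>)"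

definition T_matrix :: "(real \<Rightarrow> real) \<Rightarrow> nat \<Rightarrow> nat \<Rightarrow> nat \<Rightarrow> (int \<Rightarrow> 'a \<Rightarrow> real vec) \<Rightarrow>
    (int \<Rightarrow> 'a \<Rightarrow> real) \<Rightarrow> real vec \<Rightarrow> nat \<Rightarrow> 'a \<Rightarrow> real mat" where
  "T_matrix g r p q X Y \<gamma> n \<omega> =
     mat_diag n (\<lambda>i. 1 / deriv g (mu g r p q X Y \<gamma> (Suc i) \<omega>))"

definition E_matrix :: "(real \<Rightarrow> real) \<Rightarrow> nat \<Rightarrow> nat \<Rightarrow> nat \<Rightarrow> (int \<Rightarrow> 'a \<Rightarrow> real vec) \<Rightarrow>
    (int \<Rightarrow> 'a \<Rightarrow> real) \<Rightarrow> real vec \<Rightarrow> nat \<Rightarrow> 'a \<Rightarrow> real mat" where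
  "E_matrix g r p q X Y \<gamma> n \<omega> =
     mat_diag n (\<lambda>i. let m = mu g r p q X Y \<gamma> (Suc i) \<omega>
                     in (2 - (1 - m)\<^sup>2) / (m\<^sup>2 * (1 - m)\<^sup>2))"

end

theory Submission
  imports Defs "HOL-Real_Asymp.Real_Asymp"
begin

text \<open>
  As a function of \<open>y\<close>, every derivative of the log-likelihood in \<open>\<mu>\<close> is affine in the odds
  \<open>z = y / (1 - y)\<close>, so all conditional expectations follow from the mean
  \<open>\<mu> (1 + \<mu>) / (1 - \<mu>)\<close> of \<open>z\<close> under \<open>UL \<mu>\<close>. With \<open>h = g\<^sup>-\<^sup>1\<close> and \<open>\<mu> = h \<eta>\<close> the chain rule gives
  \<open>\<partial>\<^sub>i\<partial>\<^sub>j \<ell> = \<ell>'' (h')\<^sup>2 \<partial>\<^sub>i\<eta> \<partial>\<^sub>j\<eta> + \<ell>' (h'' \<partial>\<^sub>i\<eta> \<partial>\<^sub>j\<eta> + h' \<partial>\<^sub>i\<partial>\<^sub>j\<eta>)\<close>; the score \<open>\<ell>'\<close> has conditional mean 0 and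
  \<open>h' = 1 / g' \<circ> h\<close>, which leaves the entries of \<open>D' T E T D\<close>. Since \<open>g (h x) = x\<close>, the predictor \<open>\<eta>\<close> is
  a polynomial in the parameters whose coefficients depend measurably on the past; this yields both
  its smoothness and the measurability of the coefficients of the affine function of \<open>z\<close>.
\<close>

section \<open>Moments of the unit-Lindley distribution\<close>

text \<open>First and second derivative of \<open>UL_loglik\<close> in \<open>m\<close>, sorted by
  powers of the odds so that their means need only the mean odds.\<close>

definition UL_score :: "real \<Rightarrow> real \<Rightarrow> real" where
  "UL_score m y = - 2 / (1 - m) - 1 / m + 1 / m\<^sup>2 * (y / (1 - y))"

definition UL_curv :: "real \<Rightarrow> real \<Rightarrow> real" where
  "UL_curv m y = - 2 / (1 - m)\<^sup>2 + 1 / m\<^sup>2 - 2 / m ^ 3 * (y / (1 - y))"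

lemma DERIV_UL_loglik:
  assumes "0 < m" "m < 1"
  shows "((\<lambda>m. UL_loglik m y) has_real_derivative UL_score m y) (at m)"
proof -
  \<comment> \<open>The odds are isolated as one factor. At \<open>y = 1\<close> both quotients are
    0 by division by zero, so the derivative holds for every real \<open>y\<close>.\<close>
  have *: "UL_loglik x y = 2 * ln (1 - x) - ln x - 3 * ln (1 - y) + (1 - 1 / x) * (y / (1 - y))"
    if "x \<noteq> 0" for x
    using that by (cases "y = 1") (simp_all add: UL_loglik_def field_simps)
  have "((\<lambda>x. 2 * ln (1 - x) - ln x - 3 * ln (1 - y) + (1 - 1 / x) * z)
      has_real_derivative - 2 / (1 - m) - 1 / m + 1 / m\<^sup>2 * z) (at m)" for z
    using assms by (auto intro!: derivative_eq_intros simp: power2_eq_square)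
  from this[of "y / (1 - y)"]
  have "((\<lambda>x. 2 * ln (1 - x) - ln x - 3 * ln (1 - y) + (1 - 1 / x) * (y / (1 - y)))
      has_real_derivative UL_score m y) (at m)"
    by (simp only: UL_score_def)
  then show ?thesis
    by (rule DERIV_cong_ev[THEN iffD1, rotated -1])
       (use assms * in \<open>auto intro!: eventually_mono[OF t1_space_nhds[of m 0]]\<close>)
qed

lemma DERIV_UL_score:
  assumes "0 < m" "m < 1"
  shows "((\<lambda>m. UL_score m y) has_real_derivative UL_curv m y) (at m)"
proof -
  have eq: "- 2 * m / (m\<^sup>2)\<^sup>2 = - (2 / m ^ 3)"
    using assms by (simp add: field_simps eval_nat_numeral)
  have "((\<lambda>m. - 2 / (1 - m) - 1 / m + 1 / m\<^sup>2 * z)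
      has_real_derivative - 2 / (1 - m)\<^sup>2 + 1 / m\<^sup>2 + - 2 * m / (m\<^sup>2)\<^sup>2 * z) (at m)" for z
    using assms by (auto intro!: derivative_eq_intros simp: power2_eq_square)
  from this[of "y / (1 - y)", unfolded eq] show ?thesis
    by (simp add: UL_score_def UL_curv_def)
qed

lemma deriv2_UL_loglik:
  assumes "0 < m" "m < 1"
  shows "(deriv ^^ 2) (\<lambda>m. UL_loglik m y) m = UL_curv m y"
proof -
  have "(deriv ^^ 2) (\<lambda>m. UL_loglik m y) m = deriv (deriv (\<lambda>m. UL_loglik m y)) m"
    by (simp add: numeral_2_eq_2)
  also have "\<dots> = deriv (\<lambda>m. UL_score m y) m"
  proof (rule deriv_cong_ev)
    have "\<forall>\<^sub>F x in nhds m. x \<in> {0<..<1}"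
      using assms by (intro eventually_nhds_in_open) auto
    then show "\<forall>\<^sub>F x in nhds m. deriv (\<lambda>m. UL_loglik m y) x = UL_score x y"
      by eventually_elim (auto intro!: DERIV_imp_deriv DERIV_UL_loglik)
  qed simp
  also have "\<dots> = UL_curv m y"
    by (rule DERIV_imp_deriv) (rule DERIV_UL_score[OF assms])
  finally show ?thesis .
qed

text \<open>The mean \<open>(\<theta> + 2) / (\<theta> * (\<theta> + 1))\<close> of the Lindley
  distribution, with \<open>\<theta> = (1 - m) / m\<close>.\<close>

definition UL_odds_mean :: "real \<Rightarrow> real" where
  "UL_odds_mean m = m * (1 + m) / (1 - m)"

lemma DERIV_odds:
  assumes "y < (1::real)"
  shows "((\<lambda>y. y / (1 - y)) has_real_derivative 1 / (1 - y)\<^sup>2) (at y)"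
  using assms by (auto intro!: derivative_eq_intros simp: power2_eq_square field_simps)

text \<open>In the variable \<open>z = y / (1 - y)\<close> the unit-Lindley density becomes the Lindley density
  \<open>m \<theta>\<^sup>2 (1 + z) exp (- \<theta> z)\<close> with \<open>\<theta> = (1 - m) / m\<close>.\<close>

lemma UL_density_odds:
  assumes "0 < m" "m < 1" "y < 1"
  defines "z \<equiv> y / (1 - y)" and "\<theta> \<equiv> (1 - m) / m"
  shows "UL_density m y = m * \<theta>\<^sup>2 * (1 + z) * exp (- (\<theta> * z)) * (1 / (1 - y)\<^sup>2)"
proof -
  have "y * (m - 1) / (m * (1 - y)) = - (\<theta> * z)"
    using assms by (simp add: field_simps)
  moreover have "(1 - m)\<^sup>2 / (m * (1 - y) ^ 3) = m * \<theta>\<^sup>2 * (1 + z) * (1 / (1 - y)\<^sup>2)"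
    using assms by (simp add: divide_simps) (simp add: eval_nat_numeral)
  ultimately show ?thesis
    by (simp add: UL_density_def)
qed

lemma UL_density_nonneg:
  assumes "0 < m" "y < 1"
  shows "0 \<le> UL_density m y"
  using assms by (simp add: UL_density_def)

lemma isCont_UL_density:
  assumes "0 < m" "y < 1"
  shows "isCont (UL_density m) y"
  unfolding UL_density_def using assms by (intro continuous_intros) auto

text \<open>Since the integrand is nonnegative, finite one-sided limits of an antiderivative give
  integrability along with the value. Limits replace endpoint values because the odds blow up at
  1.\<close>

lemma UL_density_integral_FTC:
  fixes F w :: "real \<Rightarrow> real"
  assumes m: "0 < m" "m < 1"
    and F: "\<And>y. 0 < y \<Longrightarrow> y < 1 \<Longrightarrow> (F has_real_derivative w y * UL_density m y) (at y)"
    and w: "\<And>y. 0 < y \<Longrightarrow> y < 1 \<Longrightarrow> 0 \<le> w y" "\<And>y. 0 < y \<Longrightarrow> y < 1 \<Longrightarrow> isCont w y"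
    and lim: "(F \<longlongrightarrow> a) (at_right 0)" "(F \<longlongrightarrow> b) (at_left 1)"
  shows "set_integrable lborel {0<..<1} (\<lambda>y. w y * UL_density m y)"
    and "(LBINT y:{0<..<1}. w y * UL_density m y) = b - a"
proof -
  have 1: "einterval 0 1 = {0<..<1::real}"
    by (auto simp: einterval_def)
  have *: "set_integrable lborel (einterval 0 1) (\<lambda>y. w y * UL_density m y)"
    "(LBINT y=0..1. w y * UL_density m y) = b - a"
    by (rule interval_integral_FTC_nonneg[where F = F and A = a and B = b],
        use assms in \<open>auto simp: ereal_tendsto_simps1 zero_ereal_def one_ereal_def
          intro!: isCont_mult isCont_UL_density mult_nonneg_nonneg UL_density_nonneg\<close>)+
  show "set_integrable lborel {0<..<1} (\<lambda>y. w y * UL_density m y)"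
    using *(1) unfolding 1 .
  show "(LBINT y:{0<..<1}. w y * UL_density m y) = b - a"
    using *(2) unfolding interval_lebesgue_integral_def 1 by simp
qed

lemma UL_density_mass:
  assumes m: "0 < m" "m < 1"
  shows "set_integrable lborel {0<..<1} (UL_density m)"
    and "(LBINT y:{0<..<1}. UL_density m y) = 1"
proof -
  define \<theta> where "\<theta> = (1 - m) / m"
  have \<theta>: "\<theta> > 0" using m by (simp add: \<theta>_def)
  have m1: "m * (\<theta> + 1) = 1" using m by (simp add: \<theta>_def field_simps)
  \<comment> \<open>Antiderivative of the Lindley density in \<open>z\<close>, by parts. It is -1 at
    \<open>z = 0\<close>, by \<open>m1\<close>, and tends to 0 at infinity.\<close>
  define G where "G z = - (m * exp (- (\<theta> * z)) * (\<theta> * (1 + z) + 1))" for z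
  have G: "(G has_real_derivative m * \<theta>\<^sup>2 * (1 + z) * exp (- (\<theta> * z))) (at z)" for z
    unfolding G_def by (auto intro!: derivative_eq_intros simp: algebra_simps power2_eq_square)
  define F where "F y = G (y / (1 - y))" for y
  have F: "(F has_real_derivative 1 * UL_density m y) (at y)" if "0 < y" "y < 1" for y
    unfolding UL_density_odds[OF m that(2)] F_def \<theta>_def[symmetric]
    using DERIV_chain2[OF G DERIV_odds[OF that(2)]] by simp
  have lim0: "(F \<longlongrightarrow> - 1) (at_right 0)"
  proof -
    have "(F \<longlongrightarrow> - (m * (\<theta> + 1))) (at_right 0)"
      unfolding F_def G_def using \<theta> m by real_asymp
    then show ?thesis by (simp only: m1)
  qed
  have lim1: "(F \<longlongrightarrow> 0) (at_left 1)"
    unfolding F_def G_def using \<theta> m by real_asymp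
  note * = UL_density_integral_FTC[OF m F _ _ lim0 lim1]
  show "set_integrable lborel {0<..<1} (UL_density m)"
    using *(1) by simp
  show "(LBINT y:{0<..<1}. UL_density m y) = 1"
    using *(2) by simp
qed

lemma UL_density_odds_moment:
  assumes m: "0 < m" "m < 1"
  shows "set_integrable lborel {0<..<1} (\<lambda>y. y / (1 - y) * UL_density m y)"
    and "(LBINT y:{0<..<1}. y / (1 - y) * UL_density m y) = UL_odds_mean m"
proof -
  define \<theta> where "\<theta> = (1 - m) / m"
  have \<theta>: "\<theta> > 0" using m by (simp add: \<theta>_def)
  have m1: "m * (\<theta> + 2) / \<theta> = UL_odds_mean m"
    using m by (simp add: \<theta>_def UL_odds_mean_def field_simps)
  \<comment> \<open>Repeated integration by parts: the bracket is
    \<open>\<theta> * P + P' + P'' / \<theta>\<close> for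
    \<open>P z = z + z\<^sup>2\<close>.\<close>
  define G where "G z = - (m * exp (- (\<theta> * z)) * (\<theta> * (z + z\<^sup>2) + (1 + 2 * z) + 2 / \<theta>))" for z
  have G: "(G has_real_derivative z * (m * \<theta>\<^sup>2 * (1 + z) * exp (- (\<theta> * z)))) (at z)" for z
    unfolding G_def using \<theta>
    by (auto intro!: derivative_eq_intros simp: field_simps power2_eq_square)
  define F where "F y = G (y / (1 - y))" for y
  have F: "(F has_real_derivative y / (1 - y) * UL_density m y) (at y)" if "0 < y" "y < 1" for y
    unfolding UL_density_odds[OF m that(2)] F_def \<theta>_def[symmetric]
    using DERIV_chain2[OF G DERIV_odds[OF that(2)]] by (simp add: mult_ac)
  have lim0: "(F \<longlongrightarrow> - UL_odds_mean m) (at_right 0)"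
  proof -
    have "(F \<longlongrightarrow> - (m * (1 + 2 / \<theta>))) (at_right 0)"
      unfolding F_def G_def using \<theta> m by real_asymp
    also have "m * (1 + 2 / \<theta>) = m * (\<theta> + 2) / \<theta>"
      using \<theta> by (simp add: field_simps)
    finally show ?thesis by (simp only: m1)
  qed
  have lim1: "(F \<longlongrightarrow> 0) (at_left 1)"
    unfolding F_def G_def using \<theta> m by real_asymp
  note * = UL_density_integral_FTC[OF m F _ _ lim0 lim1]
  show "set_integrable lborel {0<..<1} (\<lambda>y. y / (1 - y) * UL_density m y)"
    using *(1) by simp
  show "(LBINT y:{0<..<1}. y / (1 - y) * UL_density m y) = UL_odds_mean m"
    using *(2) by simp
qed

lemma UL_density_indicator_nonneg:
  assumes "0 < m"
  shows "0 \<le> UL_density m y * indicator {0<..<1} y"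
  using assms by (auto simp: indicator_def UL_density_nonneg)

lemma UL_affine_odds:
  assumes m: "0 < m" "m < 1"
  shows "integrable (UL m) (\<lambda>y. a + b * (y / (1 - y)))"
    and "(\<integral>y. a + b * (y / (1 - y)) \<partial>UL m) = a + b * UL_odds_mean m"
proof -
  have [measurable]: "UL_density m \<in> borel_measurable borel"
    unfolding UL_density_def by measurable
  let ?d = "\<lambda>y. UL_density m y * indicator {0<..<1} y"
  have *: "?d y *\<^sub>R (a + b * (y / (1 - y)))
    = a * (indicator {0<..<1} y *\<^sub>R UL_density m y)
      + b * (indicator {0<..<1} y *\<^sub>R (y / (1 - y) * UL_density m y))" for y
    by (simp add: algebra_simps)
  note i0 = UL_density_mass[OF m, unfolded set_integrable_def set_lebesgue_integral_def]
  note i1 = UL_density_odds_moment[OF m, unfolded set_integrable_def set_lebesgue_integral_def]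
  have "integrable lborel (\<lambda>y. ?d y *\<^sub>R (a + b * (y / (1 - y))))"
    unfolding * by (intro Bochner_Integration.integrable_add integrable_mult_right i0 i1)
  then show "integrable (UL m) (\<lambda>y. a + b * (y / (1 - y)))"
    unfolding UL_def by (subst integrable_density) (auto simp: UL_density_indicator_nonneg m)
  have "(\<integral>y. a + b * (y / (1 - y)) \<partial>UL m) = (\<integral>y. ?d y *\<^sub>R (a + b * (y / (1 - y))) \<partial>lborel)"
    unfolding UL_def by (subst integral_density) (auto simp: UL_density_indicator_nonneg m)
  also have "\<dots> = a + b * UL_odds_mean m"
    unfolding * using i0 i1
    by (subst Bochner_Integration.integral_add)
      (auto simp only: integral_mult_right_zero intro!: integrable_mult_right)
  finally show "(\<integral>y. a + b * (y / (1 - y)) \<partial>UL m) = a + b * UL_odds_mean m" .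
qed

text \<open>Finiteness lets the real-valued \<open>measure\<close> in the conditional law be read as
  an \<open>emeasure\<close>.\<close>

lemma prob_space_UL:
  assumes m: "0 < m" "m < 1"
  shows "prob_space (UL m)"
proof
  have [measurable]: "UL_density m \<in> borel_measurable borel"
    unfolding UL_density_def by measurable
  let ?d = "\<lambda>y. UL_density m y * indicator {0<..<1} y"
  have "emeasure (UL m) (space (UL m)) = (\<integral>\<^sup>+ y. ennreal (?d y) \<partial>lborel)"
    unfolding UL_def by (simp add: emeasure_density)
  also have "\<dots> = ennreal (\<integral>y. ?d y \<partial>lborel)"
    using UL_density_mass(1)[OF m] UL_density_indicator_nonneg[OF m(1)]
    by (intro nn_integral_eq_integral) (auto simp: set_integrable_def mult.commute)
  also have "(\<integral>y. ?d y \<partial>lborel) = 1"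
    using UL_density_mass(2)[OF m] by (simp add: set_lebesgue_integral_def mult.commute)
  finally show "emeasure (UL m) (space (UL m)) = 1" by simp
qed

text \<open>The coefficients of \<open>UL_score\<close> with the odds replaced by their mean: the
  score is centred, which removes all terms with second derivatives of the inverse link or of the
  predictor.\<close>

lemma UL_score_mean:
  assumes "0 < m" "m < 1"
  shows "- 2 / (1 - m) - 1 / m + 1 / m\<^sup>2 * UL_odds_mean m = 0"
  using assms by (simp add: UL_odds_mean_def divide_simps) (simp add: algebra_simps power2_eq_square)

text \<open>The same substitution in \<open>UL_curv\<close> gives minus the Fisher information of
  \<open>UL m\<close>.\<close>

lemma UL_curv_mean:
  assumes "0 < m" "m < 1"
  shows "- 2 / (1 - m)\<^sup>2 + 1 / m\<^sup>2 - 2 / m ^ 3 * UL_odds_mean m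
    = - ((2 - (1 - m)\<^sup>2) / (m\<^sup>2 * (1 - m)\<^sup>2))"
  using assms by (simp add: UL_odds_mean_def divide_simps) (simp add: algebra_simps eval_nat_numeral)

section \<open>Conditional expectation and conditional densities\<close>

context sigma_finite_subalgebra
begin

text \<open>A conditional density \<open>k\<close> of \<open>Z\<close> given \<open>F\<close> also integrates functions \<open>h\<close> that depend
  \<open>F\<close>-measurably on the sample point: the law of \<open>(\<omega>, Z \<omega>)\<close> on \<open>F \<Otimes> borel\<close> and the measure with
  density \<open>k\<close> with respect to \<open>M|F \<Otimes> lborel\<close> agree on rectangles.\<close>

lemma nn_cond_exp_cond_density:
  fixes Z :: "'a \<Rightarrow> real" and k :: "'a \<Rightarrow> real \<Rightarrow> ennreal" and h :: "'a \<Rightarrow> real \<Rightarrow> ennreal"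
  assumes fin: "finite_measure M"
    and Z [measurable]: "Z \<in> borel_measurable M"
    and k [measurable]: "case_prod k \<in> borel_measurable (F \<Otimes>\<^sub>M borel)"
    and law: "\<And>A. A \<in> sets borel \<Longrightarrow>
      AE x in M. nn_cond_exp M F (\<lambda>x. indicator A (Z x)) x = (\<integral>\<^sup>+ y. k x y * indicator A y \<partial>lborel)"
    and h [measurable]: "case_prod h \<in> borel_measurable (F \<Otimes>\<^sub>M borel)"
  shows "AE x in M. nn_cond_exp M F (\<lambda>x. h x (Z x)) x = (\<integral>\<^sup>+ y. k x y * h x y \<partial>lborel)"
proof -
  interpret finite_measure M by fact
  let ?R = "restr_to_subalg M F"
  have FM [measurable_dest]: "A \<in> sets F \<Longrightarrow> A \<in> sets M" for A
    using subalg by (auto simp: subalgebra_def)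
  have sR [measurable_cong]: "sets ?R = sets F"
    using subalg by (simp add: sets_restr_to_subalg)
  have idF [measurable]: "(\<lambda>x. x) \<in> measurable M F"
    using subalg by (auto simp: subalgebra_def measurable_def)
  have rest: "(\<integral>\<^sup>+ x. f x \<partial>?R) = (\<integral>\<^sup>+ x. f x \<partial>M)" if "f \<in> borel_measurable F" for f :: "'a \<Rightarrow> ennreal"
    using nn_integral_subalgebra2[OF subalg that] .
  define N1 where "N1 = distr M (F \<Otimes>\<^sub>M borel) (\<lambda>x. (x, Z x))"
  \<comment> \<open>The base measure is restricted to \<open>F\<close> so that \<open>N2\<close>
    lives on the same sigma-algebra as \<open>N1\<close>; \<open>rest\<close> turns integrals over
    \<open>?R\<close> back into integrals over \<open>M\<close>.\<close>
  define N2 where "N2 = density (?R \<Otimes>\<^sub>M lborel) (\<lambda>(x, y). k x y)"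
  have sets1: "sets N1 = sets (F \<Otimes>\<^sub>M borel)" by (simp add: N1_def)
  have sets2: "sets N2 = sets (F \<Otimes>\<^sub>M borel)"
    unfolding N2_def sets_density by (rule sets_pair_measure_cong) (simp_all add: sR)
  have k' [measurable]: "case_prod k \<in> borel_measurable (?R \<Otimes>\<^sub>M lborel)"
    using k by (simp cong: measurable_cong_sets add: sets_pair_measure_cong[OF sR sets_lborel])
  have int2: "(\<integral>\<^sup>+ w. f w \<partial>N2) = (\<integral>\<^sup>+ x. \<integral>\<^sup>+ y. k x y * f (x, y) \<partial>lborel \<partial>M)"
    if f: "f \<in> borel_measurable (F \<Otimes>\<^sub>M borel)" for f
  proof -
    have f' [measurable]: "f \<in> borel_measurable (?R \<Otimes>\<^sub>M lborel)"
      using f by (simp cong: measurable_cong_sets add: sets_pair_measure_cong[OF sR sets_lborel])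
    have "(\<integral>\<^sup>+ w. f w \<partial>N2) = (\<integral>\<^sup>+ w. (case w of (x, y) \<Rightarrow> k x y) * f w \<partial>(?R \<Otimes>\<^sub>M lborel))"
      unfolding N2_def by (rule nn_integral_density) measurable
    also have "\<dots> = (\<integral>\<^sup>+ x. \<integral>\<^sup>+ y. k x y * f (x, y) \<partial>lborel \<partial>?R)"
      by (subst lborel.nn_integral_fst[symmetric]) simp_all
    also have "\<dots> = (\<integral>\<^sup>+ x. \<integral>\<^sup>+ y. k x y * f (x, y) \<partial>lborel \<partial>M)"
    proof (rule rest)
      have [measurable]: "(\<lambda>(x, y). k x y * f (x, y)) \<in> borel_measurable (F \<Otimes>\<^sub>M lborel)"
        using f k by measurable
      show "(\<lambda>x. \<integral>\<^sup>+ y. k x y * f (x, y) \<partial>lborel) \<in> borel_measurable F"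
        by measurable
    qed
    finally show ?thesis .
  qed
  have int1: "(\<integral>\<^sup>+ w. f w \<partial>N1) = (\<integral>\<^sup>+ x. f (x, Z x) \<partial>M)"
    if f: "f \<in> borel_measurable (F \<Otimes>\<^sub>M borel)" for f
    unfolding N1_def by (rule nn_integral_distr) (use f in measurable)
  let ?E = "{B \<times> A | B A. B \<in> sets F \<and> A \<in> sets (borel :: real measure)}"
  have "N1 = N2"
  proof (rule measure_eqI_generator_eq[where E = ?E and \<Omega> = "space F \<times> space borel"
        and A = "\<lambda>_. space F \<times> space borel"])
    show "Int_stable ?E" by (rule Int_stable_pair_measure_generator)
    show "?E \<subseteq> Pow (space F \<times> space borel)" by (rule pair_measure_closed)
    show "sets N1 = sigma_sets (space F \<times> space borel) ?E"
      unfolding sets1 by (rule sets_pair_measure)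
    show "sets N2 = sigma_sets (space F \<times> space borel) ?E"
      unfolding sets2 by (rule sets_pair_measure)
    show "range (\<lambda>_. space F \<times> space borel) \<subseteq> ?E"
      by (intro image_subsetI CollectI exI[of _ "space F"] exI[of _ "space borel"] conjI) auto
    show "(\<Union>i. space F \<times> space borel) = space F \<times> space (borel :: real measure)" by simp
    \<comment> \<open>Finiteness of \<open>M\<close> allows the constant exhausting
      sequence.\<close>
    show "emeasure N1 (space F \<times> space borel) \<noteq> \<infinity>"
      unfolding N1_def by (subst emeasure_distr) (simp_all add: emeasure_finite)
    fix W assume "W \<in> ?E"
    then obtain B A where W: "W = B \<times> A" and B [measurable]: "B \<in> sets F" and A [measurable]: "A \<in> sets borel"
      by auto
    have WF [measurable]: "W \<in> sets (F \<Otimes>\<^sub>M borel)" unfolding W by simp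
    have ind: "indicator W (x, y) = (indicator B x * indicator A y :: ennreal)" for x y
      by (simp add: W indicator_times)
    have "emeasure N1 W = (\<integral>\<^sup>+ x. indicator B x * indicator A (Z x) \<partial>M)"
      using int1[of "indicator W"] WF by (simp add: sets1 ind)
    \<comment> \<open>Defining property of conditional expectation, with the
      \<open>F\<close>-measurable weight \<open>indicator B\<close>.\<close>
    also have "\<dots> = (\<integral>\<^sup>+ x. indicator B x * nn_cond_exp M F (\<lambda>x. indicator A (Z x)) x \<partial>M)"
      by (rule nn_cond_exp_intg[symmetric]) measurable
    also have "\<dots> = (\<integral>\<^sup>+ x. indicator B x * (\<integral>\<^sup>+ y. k x y * indicator A y \<partial>lborel) \<partial>M)"
      by (rule nn_integral_cong_AE) (use law[OF A] in auto)
    also have "\<dots> = (\<integral>\<^sup>+ x. \<integral>\<^sup>+ y. k x y * indicator W (x, y) \<partial>lborel \<partial>M)"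
    proof (rule nn_integral_cong)
      show "indicator B x * (\<integral>\<^sup>+ y. k x y * indicator A y \<partial>lborel)
          = (\<integral>\<^sup>+ y. k x y * indicator W (x, y) \<partial>lborel)" for x
        by (cases "x \<in> B") (simp_all add: ind)
    qed
    also have "\<dots> = emeasure N2 W"
      using int2[of "indicator W"] WF by (simp add: sets2)
    finally show "emeasure N1 W = emeasure N2 W" .
  qed
  \<comment> \<open>The conditional expectation is identified by its integrals over sets
    \<open>B\<close> of \<open>F\<close>; for these, equality of the two measures is applied to
    \<open>h x y * indicator B x\<close>.\<close>
  have "AE x in M. (\<integral>\<^sup>+ y. k x y * h x y \<partial>lborel) = nn_cond_exp M F (\<lambda>x. h x (Z x)) x"
  proof (rule nn_cond_exp_charact)
    fix B assume B [measurable]: "B \<in> sets F"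
    have f [measurable]: "(\<lambda>(x, y). h x y * indicator B x) \<in> borel_measurable (F \<Otimes>\<^sub>M borel)"
      by measurable
    show "(\<integral>\<^sup>+ x \<in> B. h x (Z x) \<partial>M) = (\<integral>\<^sup>+ x \<in> B. (\<integral>\<^sup>+ y. k x y * h x y \<partial>lborel) \<partial>M)"
    proof -
      have "(\<integral>\<^sup>+ x \<in> B. h x (Z x) \<partial>M) = (\<integral>\<^sup>+ x. \<integral>\<^sup>+ y. k x y * (h x y * indicator B x) \<partial>lborel \<partial>M)"
        using int1[OF f] int2[OF f] by (simp add: \<open>N1 = N2\<close>)
      also have "\<dots> = (\<integral>\<^sup>+ x \<in> B. (\<integral>\<^sup>+ y. k x y * h x y \<partial>lborel) \<partial>M)"
      proof (rule nn_integral_cong)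
        show "(\<integral>\<^sup>+ y. k x y * (h x y * indicator B x) \<partial>lborel)
            = (\<integral>\<^sup>+ y. k x y * h x y \<partial>lborel) * indicator B x" for x
          by (cases "x \<in> B") simp_all
      qed
      finally show ?thesis .
    qed
  next
    have "(\<lambda>x. (\<lambda>(x, y). h x y) (x, Z x)) \<in> borel_measurable M"
      by measurable
    then show "(\<lambda>x. h x (Z x)) \<in> borel_measurable M" by simp
    show "(\<lambda>x. \<integral>\<^sup>+ y. k x y * h x y \<partial>lborel) \<in> borel_measurable F"
      by measurable
  qed
  then show ?thesis by eventually_elim simp
qed

end

context sigma_finite_subalgebra
begin

text \<open>The negative part vanishes, and the bound by 1 keeps the nonnegative conditional
  expectation finite, so nothing is lost in passing to the reals.\<close>

lemma nn_cond_exp_eq_real_cond_exp: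
  assumes [measurable]: "f \<in> borel_measurable M" and f: "\<And>x. 0 \<le> f x" "\<And>x. f x \<le> 1"
  shows "AE x in M. nn_cond_exp M F (\<lambda>x. ennreal (f x)) x = ennreal (real_cond_exp M F f x)"
proof -
  have 0: "ennreal (- f x) = 0" for x
    using f(1)[of x] by (simp add: ennreal_neg)
  have "AE x in M. nn_cond_exp M F (\<lambda>x. ennreal (f x)) x \<le> nn_cond_exp M F (\<lambda>x. 1) x"
    by (rule nn_cond_exp_mono) (use f in auto)
  moreover have "AE x in M. 1 = nn_cond_exp M F (\<lambda>x. 1) x"
    by (rule nn_cond_exp_F_meas) simp
  moreover have "AE x in M. 0 = nn_cond_exp M F (\<lambda>x. 0) x"
    by (rule nn_cond_exp_F_meas) simp
  ultimately show ?thesis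
  proof eventually_elim
    case (elim x)
    then have "nn_cond_exp M F (\<lambda>x. ennreal (f x)) x < \<top>"
      by (metis ennreal_one_less_top order.strict_trans1)
    with elim show ?case
      by (simp add: real_cond_exp_def 0)
  qed
qed

text \<open>The function need not be integrable over \<open>M\<close>: \<open>real_cond_exp\<close> is by definition the difference of
  the conditional expectations of the positive and negative parts, each of which the conditional
  density evaluates, and the resulting integrals against \<open>UL (m x)\<close> are finite.\<close>

lemma real_cond_exp_UL_affine_odds:
  fixes Z m c0 c1 :: "'a \<Rightarrow> real"
  assumes fin: "finite_measure M"
    and Z [measurable]: "Z \<in> borel_measurable M"
    and m [measurable]: "m \<in> borel_measurable F"
    and m01: "\<And>x. 0 < m x" "\<And>x. m x < 1"
    and law: "\<And>A. A \<in> sets borel \<Longrightarrow>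
      AE x in M. real_cond_exp M F (\<lambda>x. indicator A (Z x)) x = measure (UL (m x)) A"
    and c [measurable]: "c0 \<in> borel_measurable F" "c1 \<in> borel_measurable F"
  shows "AE x in M. real_cond_exp M F (\<lambda>x. c0 x + c1 x * (Z x / (1 - Z x))) x
    = c0 x + c1 x * UL_odds_mean (m x)"
proof -
  define k where "k x y = ennreal (UL_density (m x) y * indicator {0<..<1} y)" for x y
  define h where "h x y = c0 x + c1 x * (y / (1 - y))" for x y
  have UL: "UL (m x) = density lborel (k x)" for x
    unfolding UL_def k_def ..
  have [measurable]: "UL_density a \<in> borel_measurable borel" for a
    unfolding UL_density_def by measurable
  have [measurable]: "case_prod k \<in> borel_measurable (F \<Otimes>\<^sub>M borel)"
    unfolding k_def UL_density_def by measurable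
  have [measurable]: "k x \<in> borel_measurable borel" for x
    unfolding k_def by measurable
  have [measurable]: "h x \<in> borel_measurable borel" for x
    unfolding h_def by measurable
  have emeasure_UL: "emeasure (UL (m x)) A = (\<integral>\<^sup>+ y. k x y * indicator A y \<partial>lborel)"
    if "A \<in> sets borel" for x A
    unfolding UL by (rule emeasure_density) (use that in auto)
  have law': "AE x in M. nn_cond_exp M F (\<lambda>x. indicator A (Z x)) x
      = (\<integral>\<^sup>+ y. k x y * indicator A y \<partial>lborel)" if A [measurable]: "A \<in> sets borel" for A
  proof -
    have "AE x in M. nn_cond_exp M F (\<lambda>x. ennreal (indicator A (Z x))) x
        = ennreal (real_cond_exp M F (\<lambda>x. indicator A (Z x)) x)"
      by (rule nn_cond_exp_eq_real_cond_exp) (auto simp: indicator_def)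
    with law[OF A] show ?thesis
    proof eventually_elim
      case (elim x)
      interpret prob_space "UL (m x)" by (rule prob_space_UL[OF m01])
      from elim show ?case
        by (simp add: emeasure_eq_measure ennreal_indicator flip: emeasure_UL[OF A])
    qed
  qed
  have nn: "AE x in M. nn_cond_exp M F (\<lambda>x. ennreal (w x (Z x))) x = (\<integral>\<^sup>+ y. k x y * ennreal (w x y) \<partial>lborel)"
    if "case_prod w \<in> borel_measurable (F \<Otimes>\<^sub>M borel)" for w :: "'a \<Rightarrow> real \<Rightarrow> real"
  proof (rule nn_cond_exp_cond_density[OF fin Z _ law'])
    note [measurable] = that
    show "(\<lambda>(x, y). ennreal (w x y)) \<in> borel_measurable (F \<Otimes>\<^sub>M borel)"
      by measurable
    show "case_prod k \<in> borel_measurable (F \<Otimes>\<^sub>M borel)"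
      by measurable
  qed
  \<comment> \<open>\<open>ennreal\<close> truncates at 0, so \<open>h\<close> and
    \<open>- h\<close> supply the positive and negative parts.\<close>
  have "AE x in M. nn_cond_exp M F (\<lambda>x. ennreal (h x (Z x))) x = (\<integral>\<^sup>+ y. k x y * ennreal (h x y) \<partial>lborel)"
    by (rule nn) (simp add: h_def)
  moreover have "AE x in M. nn_cond_exp M F (\<lambda>x. ennreal (- h x (Z x))) x
      = (\<integral>\<^sup>+ y. k x y * ennreal (- h x y) \<partial>lborel)"
    by (rule nn) (simp add: h_def)
  ultimately have "AE x in M. real_cond_exp M F (\<lambda>x. h x (Z x)) x = (\<integral>y. h x y \<partial>UL (m x))"
  proof eventually_elim
    case (elim x)
    have "integrable (UL (m x)) (h x)"
      unfolding h_def by (rule UL_affine_odds(1)[OF m01])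
    then have "(\<integral>y. h x y \<partial>UL (m x)) = enn2real (\<integral>\<^sup>+ y. ennreal (h x y) \<partial>UL (m x))
        - enn2real (\<integral>\<^sup>+ y. ennreal (- h x y) \<partial>UL (m x))"
      by (rule real_lebesgue_integral_def)
    with elim show ?case
      unfolding real_cond_exp_def UL by (simp add: nn_integral_density)
  qed
  then show ?thesis
    unfolding h_def UL_affine_odds(2)[OF m01] .
qed

end

section \<open>The inverse link\<close>

text \<open>A derivative is the pointwise limit of difference quotients with steps
  \<open>1 / (n + 1)\<close>. This covers \<open>h''\<close>, whose continuity does not follow from
  a link that is merely twice differentiable.\<close>

lemma borel_measurable_DERIV:
  fixes f :: "real \<Rightarrow> real"
  assumes "\<And>x. (f has_real_derivative f' x) (at x)"
  shows "f' \<in> borel_measurable borel"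
proof (rule borel_measurable_LIMSEQ_real)
  have "isCont f x" for x
    using assms DERIV_isCont by blast
  then have [measurable]: "f \<in> borel_measurable borel"
    by (simp add: borel_measurable_continuous_onI continuous_at_imp_continuous_on)
  show "(\<lambda>x. (f (x + inverse (real (Suc n))) - f x) / inverse (real (Suc n))) \<in> borel_measurable borel" for n
    by measurable
  fix x
  have "((\<lambda>h. (f (x + h) - f x) / h) \<longlongrightarrow> f' x) (at 0)"
    using assms[of x] by (simp add: DERIV_def)
  moreover have "filterlim (\<lambda>n. inverse (real (Suc n))) (at 0) sequentially"
    unfolding filterlim_at using LIMSEQ_inverse_real_of_nat by simp
  ultimately show "(\<lambda>n. (f (x + inverse (real (Suc n))) - f x) / inverse (real (Suc n))) \<longlonglongrightarrow> f' x"
    by (rule filterlim_compose)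
qed

locale link =
  fixes g :: "real \<Rightarrow> real"
  assumes link: "link_function g"
begin

abbreviation h :: "real \<Rightarrow> real" where "h \<equiv> inv_link g"

text \<open>The derivative that the inverse function theorem prescribes for \<open>h\<close>; at the
  predictor it is the diagonal entry of \<open>T_matrix\<close>.\<close>

definition h' :: "real \<Rightarrow> real" where "h' x = 1 / deriv g (h x)"

definition h'' :: "real \<Rightarrow> real" where "h'' x = deriv h' x"

lemma g_h [simp]: "g (h x) = x"
  using link unfolding link_function_def by (metis UNIV_I bij_betw_inv_into_right)

lemma h_range: "0 < h x" "h x < 1"
  using link bij_betw_inv_into[of g "{0<..<1}" UNIV] unfolding link_function_def
  by (metis UNIV_I bij_betwE greaterThanLessThan_iff)+

lemma DERIV_g: "0 < m \<Longrightarrow> m < 1 \<Longrightarrow> (g has_real_derivative deriv g m) (at m)"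
  using link unfolding link_function_def
  by (metis DERIV_deriv_iff_real_differentiable at_within_open differentiable_on_def
      greaterThanLessThan_iff open_greaterThanLessThan)

lemma deriv_g_differentiable: "0 < m \<Longrightarrow> m < 1 \<Longrightarrow> deriv g differentiable (at m)"
  using link unfolding link_function_def
  by (metis at_within_open differentiable_on_def
      greaterThanLessThan_iff open_greaterThanLessThan)

lemma deriv_g_nonzero: "0 < m \<Longrightarrow> m < 1 \<Longrightarrow> deriv g m \<noteq> 0"
  using link unfolding link_function_def by auto

lemma continuous_on_g: "continuous_on {0<..<1} g"
  using link differentiable_imp_continuous_on unfolding link_function_def by blast

text \<open>Inverse function theorem in the form that asks for continuity of \<open>g\<close> on the
  open interval and an invertible derivative at the single point \<open>h x\<close>.\<close>

lemma DERIV_h: "(h has_real_derivative h' x) (at x)"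
proof -
  have "(h has_derivative (*) (h' x)) (at x)"
  proof (rule has_derivative_inverse_strong_x[where S = "{0<..<1}" and f = g])
    show "(g has_derivative (*) (deriv g (h x))) (at (h x))"
      using DERIV_g[OF h_range] by (simp add: has_field_derivative_def)
    show "(*) (deriv g (h x)) \<circ> (*) (h' x) = id"
      using deriv_g_nonzero[OF h_range, of x] by (auto simp: h'_def fun_eq_iff)
    show "\<And>x. x \<in> {0<..<1} \<Longrightarrow> h (g x) = x"
      using link unfolding link_function_def by (meson bij_betw_inv_into_left)
  qed (use h_range continuous_on_g in auto)
  then show ?thesis by (simp add: has_field_derivative_def)
qed

lemma DERIV_h': "(h' has_real_derivative h'' x) (at x)"
proof -
  have "h' differentiable (at x)"
    unfolding h'_def
    by (intro differentiable_divide differentiable_compose[of "deriv g" h] deriv_g_differentiable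
          h_range deriv_g_nonzero differentiable_const)
       (use DERIV_h real_differentiable_def in blast)
  then show ?thesis
    unfolding h''_def using DERIV_deriv_iff_real_differentiable by blast
qed

lemma borel_measurable_h [measurable]: "h \<in> borel_measurable borel"
  using DERIV_h DERIV_isCont
  by (blast intro: borel_measurable_continuous_onI continuous_at_imp_continuous_on)

lemma borel_measurable_h' [measurable]: "h' \<in> borel_measurable borel"
  using DERIV_h by (rule borel_measurable_DERIV)

lemma borel_measurable_h'' [measurable]: "h'' \<in> borel_measurable borel"
  using DERIV_h' by (rule borel_measurable_DERIV)

text \<open>\<open>g\<close> is unconstrained outside the unit interval, so \<open>f\<close> is
  first viewed as a map into the subspace \<open>{0<..<1}\<close>, on which \<open>g\<close> is
  continuous.\<close>

lemma borel_measurable_g_compose: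
  assumes "f \<in> borel_measurable N" "\<And>x. x \<in> space N \<Longrightarrow> f x \<in> {0<..<1}"
  shows "(\<lambda>x. g (f x)) \<in> borel_measurable N"
proof -
  have "f \<in> measurable N (restrict_space borel {0<..<1})"
    using assms by (intro measurable_restrict_space2) auto
  then show ?thesis
    using borel_measurable_continuous_on_restrict[OF continuous_on_g]
    by (rule measurable_compose)
qed

end

section \<open>The linear predictor as a polynomial\<close>

text \<open>Polynomials in the first \<open>N\<close> coordinates of a vector, with
  \<open>F\<close>-measurable random coefficients. Inductive generation makes measurability and
  closure under partial derivatives accessible to induction.\<close>

inductive_set rpoly :: "'a measure \<Rightarrow> nat \<Rightarrow> ('a \<Rightarrow> real vec \<Rightarrow> real) set" for F N where
  coeff: "c \<in> borel_measurable F \<Longrightarrow> (\<lambda>\<omega> _. c \<omega>) \<in> rpoly F N"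
| coord: "k < N \<Longrightarrow> (\<lambda>_ v. v $ k) \<in> rpoly F N"
| add: "a \<in> rpoly F N \<Longrightarrow> b \<in> rpoly F N \<Longrightarrow> (\<lambda>\<omega> v. a \<omega> v + b \<omega> v) \<in> rpoly F N"
| mult: "a \<in> rpoly F N \<Longrightarrow> b \<in> rpoly F N \<Longrightarrow> (\<lambda>\<omega> v. a \<omega> v * b \<omega> v) \<in> rpoly F N"

lemma rpoly_diff:
  assumes "a \<in> rpoly F N" "b \<in> rpoly F N"
  shows "(\<lambda>\<omega> v. a \<omega> v - b \<omega> v) \<in> rpoly F N"
  using rpoly.add[OF assms(1) rpoly.mult[OF rpoly.coeff[of "\<lambda>_. - 1"] assms(2)]] by simp

lemma rpoly_sum:
  assumes "\<And>i. i \<in> I \<Longrightarrow> a i \<in> rpoly F N"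
  shows "(\<lambda>\<omega> v. \<Sum>i\<in>I. a i \<omega> v) \<in> rpoly F N"
  using assms
proof (induction I rule: infinite_finite_induct)
  case (insert i I)
  then show ?case
    using rpoly.add[of "a i" F N "\<lambda>\<omega> v. \<Sum>i\<in>I. a i \<omega> v"] by simp
qed (auto intro: rpoly.coeff[of "\<lambda>_. 0"])

lemma rpoly_measurable:
  "a \<in> rpoly F N \<Longrightarrow> (\<lambda>\<omega>. a \<omega> v) \<in> borel_measurable F"
  by (induction rule: rpoly.induct) auto

abbreviation shift :: "real vec \<Rightarrow> nat \<Rightarrow> real \<Rightarrow> real vec" where
  "shift v j s \<equiv> v + s \<cdot>\<^sub>v unit_vec (dim_vec v) j"

lemma shift_0 [simp]: "shift v j 0 = v"
  by auto

text \<open>Sum and product rules stay in the class. One \<open>a'\<close> serves all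
  \<open>\<omega>\<close> and \<open>v\<close> and lies in the class again, so the lemma can be
  iterated for second derivatives.\<close>

lemma rpoly_DERIV:
  assumes "a \<in> rpoly F N" "j < N"
  shows "\<exists>a'\<in>rpoly F N. \<forall>\<omega>. \<forall>v\<in>carrier_vec N.
    ((\<lambda>s. a \<omega> (shift v j s)) has_real_derivative a' \<omega> v) (at 0)"
  using assms(1)
proof induction
  case (coeff c)
  show ?case
    by (rule bexI[OF _ rpoly.coeff[of "\<lambda>_. 0"]]) auto
next
  case (coord k)
  have "((\<lambda>s. shift v j s $ k) has_real_derivative (if k = j then 1 else 0)) (at 0)"
    if "v \<in> carrier_vec N" for v
    using that coord by (auto intro!: derivative_eq_intros simp: unit_vec_def)
  then show ?case
    by (intro bexI[OF _ rpoly.coeff[of "\<lambda>_. if k = j then 1 else 0"]]) auto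
next
  case (add a b)
  then obtain a' b' where
    "a' \<in> rpoly F N" "b' \<in> rpoly F N"
    and "\<forall>\<omega>. \<forall>v\<in>carrier_vec N. ((\<lambda>s. a \<omega> (shift v j s)) has_real_derivative a' \<omega> v) (at 0)"
      "\<forall>\<omega>. \<forall>v\<in>carrier_vec N. ((\<lambda>s. b \<omega> (shift v j s)) has_real_derivative b' \<omega> v) (at 0)"
    by blast
  then show ?case
    by (intro bexI[OF _ rpoly.add[of a' F N b']]) (auto intro!: DERIV_add)
next
  case (mult a b)
  then obtain a' b' where *:
    "a' \<in> rpoly F N" "b' \<in> rpoly F N"
    and d: "\<forall>\<omega>. \<forall>v\<in>carrier_vec N. ((\<lambda>s. a \<omega> (shift v j s)) has_real_derivative a' \<omega> v) (at 0)"
      "\<forall>\<omega>. \<forall>v\<in>carrier_vec N. ((\<lambda>s. b \<omega> (shift v j s)) has_real_derivative b' \<omega> v) (at 0)"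
    by blast
  have "(\<lambda>\<omega> v. a' \<omega> v * b \<omega> v + b' \<omega> v * a \<omega> v) \<in> rpoly F N"
    by (intro rpoly.add rpoly.mult * mult.hyps)
  moreover have "((\<lambda>s. a \<omega> (shift v j s) * b \<omega> (shift v j s)) has_real_derivative
      a' \<omega> v * b \<omega> v + b' \<omega> v * a \<omega> v) (at 0)" if "v \<in> carrier_vec N" for \<omega> v
    using DERIV_mult[OF d(1)[rule_format, OF that, of \<omega>] d(2)[rule_format, OF that, of \<omega>]]
    by (simp only: shift_0)
  ultimately show ?case by (intro bexI) auto
qed

section \<open>Conditional information\<close>

text \<open>Fisher information of \<open>UL m\<close> about \<open>m\<close>, in the form of the
  diagonal entries of \<open>E_matrix\<close>.\<close>

definition UL_info :: "real \<Rightarrow> real" where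
  "UL_info m = (2 - (1 - m)\<^sup>2) / (m\<^sup>2 * (1 - m)\<^sup>2)"

lemma UL_curv_affine_odds:
  "UL_curv m y = (- 2 / (1 - m)\<^sup>2 + 1 / m\<^sup>2) + - (2 / m ^ 3) * (y / (1 - y))"
  by (simp add: UL_curv_def)

context link
begin

text \<open>Strong induction on time: by \<open>g_h\<close> a residual is \<open>g\<close> of an
  observation minus an earlier predictor, so \<open>g\<close> acts on observed values only and
  earlier predictors enter polynomially.\<close>

lemma eta_rpoly:
  assumes X: "\<And>s k. s \<le> int t \<Longrightarrow> k < r \<Longrightarrow> (\<lambda>\<omega>. X s \<omega> $ k) \<in> borel_measurable F"
    and Y: "\<And>s. s < int t \<Longrightarrow> Y s \<in> borel_measurable F"
    and Y01: "\<And>s \<omega>. \<omega> \<in> space F \<Longrightarrow> Y s \<omega> \<in> {0<..<1}"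
  shows "(\<lambda>\<omega> v. eta g r p q X Y v t \<omega>) \<in> rpoly F (1 + r + p + q)"
proof -
  let ?P = "rpoly F (1 + r + p + q)"
  have Xb: "(\<lambda>\<omega> v. X s \<omega> \<bullet> par_beta r v) \<in> ?P" if "s \<le> int t" for s
  proof -
    have "(\<lambda>\<omega> v. \<Sum>k\<in>{0..<r}. X s \<omega> $ k * v $ (1 + k)) \<in> ?P"
      using that by (intro rpoly_sum rpoly.mult rpoly.coeff rpoly.coord X) auto
    then show ?thesis by (simp add: scalar_prod_def par_beta_def)
  qed
  have gY: "(\<lambda>\<omega> _. g (Y s \<omega>)) \<in> ?P" if "s < int t" for s
    using Y[OF that] Y01 by (intro rpoly.coeff borel_measurable_g_compose) auto
  \<comment> \<open>The bound \<open>u \<le> t\<close> keeps one sigma-algebra \<open>F\<close> for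
    all times in the induction.\<close>
  have "(\<lambda>\<omega> v. eta g r p q X Y v u \<omega>) \<in> ?P" if "u \<le> t" for u
    using that
  proof (induction u rule: less_induct)
    case (less u)
    have resid: "(\<lambda>\<omega> v. if 1 \<le> j \<and> j < u then g (Y (int u - int j) \<omega>)
        - g (h (eta g r p q X Y v (u - j) \<omega>)) else 0) \<in> ?P" for j
    proof (cases "1 \<le> j \<and> j < u")
      case True
      then have "(\<lambda>\<omega> v. g (Y (int u - int j) \<omega>) - eta g r p q X Y v (u - j) \<omega>) \<in> ?P"
        using less by (intro rpoly_diff gY less.IH) auto
      then show ?thesis using True by simp
    next
      \<comment> \<open>The excluded indices, among them all pre-sample residuals, contribute the
        constant 0.\<close>
      case False
      show ?thesis by (simp only: False if_False) (rule rpoly.coeff, simp)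
    qed
    have "(\<lambda>\<omega> v. par_alpha v + X (int u) \<omega> \<bullet> par_beta r v
        + (\<Sum>i = 1..p. par_phi r v i *
            (g (Y (int u - int i) \<omega>) - X (int u - int i) \<omega> \<bullet> par_beta r v))
        + (\<Sum>j = 1..q. par_theta r p v j * (if 1 \<le> j \<and> j < u
            then g (Y (int u - int j) \<omega>) - g (h (eta g r p q X Y v (u - j) \<omega>)) else 0))) \<in> ?P"
      unfolding par_alpha_def par_phi_def par_theta_def
      using less.prems
      by (intro rpoly.add rpoly_sum rpoly.mult rpoly_diff rpoly.coord resid Xb gY) auto
    also have "(\<lambda>\<omega> v. par_alpha v + X (int u) \<omega> \<bullet> par_beta r v
        + (\<Sum>i = 1..p. par_phi r v i *
            (g (Y (int u - int i) \<omega>) - X (int u - int i) \<omega> \<bullet> par_beta r v))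
        + (\<Sum>j = 1..q. par_theta r p v j * (if 1 \<le> j \<and> j < u
            then g (Y (int u - int j) \<omega>) - g (h (eta g r p q X Y v (u - j) \<omega>)) else 0)))
        = (\<lambda>\<omega> v. eta g r p q X Y v u \<omega>)"
      by (intro ext) (rule eta.simps[symmetric])
    finally show ?case .
  qed
  then show ?thesis by simp
qed

text \<open>Differentiating twice gives \<open>UL_curv * Q + UL_score * W\<close>, hence an affine
  function of the odds. At the mean odds the \<open>W\<close> part vanishes and \<open>Q\<close> is
  multiplied by minus the information. Measurable coefficients are what conditioning on
  \<open>F\<close> demands.\<close>

lemma hessian_affine_odds:
  assumes a: "a \<in> rpoly F N" and ij: "i < N" "j < N" and v: "v \<in> carrier_vec N"
  shows "\<exists>c0\<in>borel_measurable F. \<exists>c1\<in>borel_measurable F.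
    (\<forall>\<omega> y. partial_deriv i (partial_deriv j (\<lambda>v. UL_loglik (h (a \<omega> v)) y)) v
       = c0 \<omega> + c1 \<omega> * (y / (1 - y))) \<and>
    (\<forall>\<omega>. c0 \<omega> + c1 \<omega> * UL_odds_mean (h (a \<omega> v))
       = - (UL_info (h (a \<omega> v)) * (h' (a \<omega> v))\<^sup>2 * partial_deriv i (a \<omega>) v * partial_deriv j (a \<omega>) v))"
proof -
  obtain ai where ai: "ai \<in> rpoly F N"
    and dai: "\<And>\<omega> v. v \<in> carrier_vec N \<Longrightarrow> ((\<lambda>s. a \<omega> (shift v i s)) has_real_derivative ai \<omega> v) (at 0)"
    using rpoly_DERIV[OF a ij(1)] by blast
  obtain aj where aj: "aj \<in> rpoly F N"
    and daj: "\<And>\<omega> v. v \<in> carrier_vec N \<Longrightarrow> ((\<lambda>s. a \<omega> (shift v j s)) has_real_derivative aj \<omega> v) (at 0)"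
    using rpoly_DERIV[OF a ij(2)] by blast
  obtain aij where aij: "aij \<in> rpoly F N"
    and daij: "\<And>\<omega> v. v \<in> carrier_vec N \<Longrightarrow> ((\<lambda>s. aj \<omega> (shift v i s)) has_real_derivative aij \<omega> v) (at 0)"
    using rpoly_DERIV[OF aj ij(1)] by blast
  have pi: "partial_deriv i (a \<omega>) v = ai \<omega> v" and pj: "partial_deriv j (a \<omega>) v = aj \<omega> v" for \<omega>
    unfolding partial_deriv_def using dai[OF v] daj[OF v] by (auto intro: DERIV_imp_deriv)
  \<comment> \<open>Stated for all \<open>w\<close> in the carrier, as it is differentiated once
    more in direction \<open>i\<close>.\<close>
  have pL: "partial_deriv j (\<lambda>v. UL_loglik (h (a \<omega> v)) y) w
      = UL_score (h (a \<omega> w)) y * (h' (a \<omega> w) * aj \<omega> w)" if w: "w \<in> carrier_vec N" for \<omega> y w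
  proof -
    have "((\<lambda>s. h (a \<omega> (shift w j s))) has_real_derivative h' (a \<omega> w) * aj \<omega> w) (at 0)"
      by (rule DERIV_chain2[OF _ daj[OF w]]) (simp add: DERIV_h)
    then have "((\<lambda>s. UL_loglik (h (a \<omega> (shift w j s))) y) has_real_derivative
        UL_score (h (a \<omega> w)) y * (h' (a \<omega> w) * aj \<omega> w)) (at 0)"
      by (rule DERIV_chain2[rotated]) (simp add: DERIV_UL_loglik h_range)
    then show ?thesis
      unfolding partial_deriv_def by (rule DERIV_imp_deriv)
  qed
  \<comment> \<open>\<open>Q\<close> multiplies the second derivative of the log-likelihood in the
    mean, \<open>W\<close> the first; \<open>W\<close> collects \<open>h''\<close> and the second
    partial \<open>aij\<close>.\<close>
  define W where "W \<omega> = h'' (a \<omega> v) * ai \<omega> v * aj \<omega> v + h' (a \<omega> v) * aij \<omega> v" for \<omega>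
  define Q where "Q \<omega> = (h' (a \<omega> v))\<^sup>2 * ai \<omega> v * aj \<omega> v" for \<omega>
  have pLL: "partial_deriv i (partial_deriv j (\<lambda>v. UL_loglik (h (a \<omega> v)) y)) v
      = UL_curv (h (a \<omega> v)) y * Q \<omega> + UL_score (h (a \<omega> v)) y * W \<omega>" for \<omega> y
  proof -
    let ?x = "\<lambda>s. shift v i s"
    have hd: "((\<lambda>s. h (a \<omega> (?x s))) has_real_derivative h' (a \<omega> v) * ai \<omega> v) (at 0)"
      by (rule DERIV_chain2[OF _ dai[OF v]]) (simp add: DERIV_h)
    have hd': "((\<lambda>s. h' (a \<omega> (?x s))) has_real_derivative h'' (a \<omega> v) * ai \<omega> v) (at 0)"
      by (rule DERIV_chain2[OF _ dai[OF v]]) (simp add: DERIV_h')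
    have sd: "((\<lambda>s. UL_score (h (a \<omega> (?x s))) y) has_real_derivative
        UL_curv (h (a \<omega> v)) y * (h' (a \<omega> v) * ai \<omega> v)) (at 0)"
      by (rule DERIV_chain2[OF _ hd]) (simp add: DERIV_UL_score h_range)
    have "((\<lambda>s. UL_score (h (a \<omega> (?x s))) y * (h' (a \<omega> (?x s)) * aj \<omega> (?x s))) has_real_derivative
        UL_curv (h (a \<omega> v)) y * Q \<omega> + UL_score (h (a \<omega> v)) y * W \<omega>) (at 0)"
      using DERIV_mult[OF sd DERIV_mult[OF hd' daij[OF v]]]
      by (rule DERIV_cong) (simp add: Q_def W_def algebra_simps power2_eq_square)
    moreover have "?x s \<in> carrier_vec N" for s
      using v by auto
    ultimately show ?thesis
      using pL unfolding partial_deriv_def[of i] by (auto intro!: DERIV_imp_deriv)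
  qed
  note [measurable] = rpoly_measurable[OF a, of v] rpoly_measurable[OF ai, of v]
    rpoly_measurable[OF aj, of v] rpoly_measurable[OF aij, of v]
  have [measurable]: "W \<in> borel_measurable F" "Q \<in> borel_measurable F"
    unfolding W_def Q_def by measurable
  define m where "m \<omega> = h (a \<omega> v)" for \<omega>
  have m01: "0 < m \<omega>" "m \<omega> < 1" for \<omega>
    by (simp_all add: m_def h_range)
  have [measurable]: "m \<in> borel_measurable F"
    unfolding m_def by measurable
  \<comment> \<open>Constant and odds coefficients collected from the affine forms of
    \<open>UL_curv\<close> and \<open>UL_score\<close>.\<close>
  let ?c0 = "\<lambda>\<omega>. (- 2 / (1 - m \<omega>)\<^sup>2 + 1 / (m \<omega>)\<^sup>2) * Q \<omega> + (- 2 / (1 - m \<omega>) - 1 / m \<omega>) * W \<omega>"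
  let ?c1 = "\<lambda>\<omega>. - (2 / m \<omega> ^ 3) * Q \<omega> + 1 / (m \<omega>)\<^sup>2 * W \<omega>"
  show ?thesis
  proof (rule bexI[of _ ?c0], rule bexI[of _ ?c1], intro conjI allI)
    show "partial_deriv i (partial_deriv j (\<lambda>v. UL_loglik (h (a \<omega> v)) y)) v
      = ?c0 \<omega> + ?c1 \<omega> * (y / (1 - y))" for \<omega> y
      unfolding pLL m_def[symmetric] UL_curv_def UL_score_def by (simp only: algebra_simps)
    show "?c0 \<omega> + ?c1 \<omega> * UL_odds_mean (h (a \<omega> v))
       = - (UL_info (h (a \<omega> v)) * (h' (a \<omega> v))\<^sup>2 * partial_deriv i (a \<omega>) v * partial_deriv j (a \<omega>) v)" for \<omega>
    proof -
      have "?c0 \<omega> + ?c1 \<omega> * UL_odds_mean (m \<omega>)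
        = (- 2 / (1 - m \<omega>)\<^sup>2 + 1 / (m \<omega>)\<^sup>2 - 2 / m \<omega> ^ 3 * UL_odds_mean (m \<omega>)) * Q \<omega>
        + (- 2 / (1 - m \<omega>) - 1 / m \<omega> + 1 / (m \<omega>)\<^sup>2 * UL_odds_mean (m \<omega>)) * W \<omega>"
        by (simp only: algebra_simps)
      also have "\<dots> = - UL_info (m \<omega>) * Q \<omega>"
        unfolding UL_score_mean[OF m01] UL_curv_mean[OF m01] UL_info_def by simp
      finally show ?thesis
        by (simp add: m_def Q_def pi pj)
    qed
  qed measurable
qed

end

section \<open>Measurability with respect to the past\<close>

lemma space_past: "space (past M r X Y t) = space M"
  unfolding past_def by (rule space_measure_of) auto

lemma sets_past:
  "sets (past M r X Y t) = sigma_sets (space M)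
     ({(\<lambda>\<omega>. X s \<omega> $ k) -` A \<inter> space M | s k A. s \<le> t + 1 \<and> k < r \<and> A \<in> sets borel} \<union>
      {Y s -` A \<inter> space M | s A. s \<le> t \<and> A \<in> sets borel})"
  unfolding past_def by (rule sets_measure_of) auto

lemma subalgebra_past:
  assumes "\<And>s k. k < r \<Longrightarrow> (\<lambda>\<omega>. X s \<omega> $ k) \<in> borel_measurable M"
    and "\<And>s. Y s \<in> borel_measurable M"
  shows "subalgebra M (past M r X Y t)"
  unfolding subalgebra_def space_past sets_past
  by (intro conjI refl sets.sigma_sets_subset)
    (auto intro: measurable_sets[OF assms(1)] measurable_sets[OF assms(2)])

text \<open>Covariates are known one step ahead, so the past up to \<open>t - 1\<close> already
  contains \<open>X t\<close>, which the predictor at time \<open>t\<close> uses.\<close>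

lemma measurable_past_X:
  "s \<le> t + 1 \<Longrightarrow> k < r \<Longrightarrow> (\<lambda>\<omega>. X s \<omega> $ k) \<in> borel_measurable (past M r X Y t)"
  by (rule measurableI) (auto simp: sets_past space_past intro!: sigma_sets.Basic)

lemma measurable_past_Y:
  "s \<le> t \<Longrightarrow> Y s \<in> borel_measurable (past M r X Y t)"
  by (rule measurableI) (auto simp: sets_past space_past intro!: sigma_sets.Basic)

section \<open>Conditional expectations in the model\<close>

context ularma
begin

sublocale link g
  by unfold_locales (rule link)

abbreviation N :: nat where "N \<equiv> 1 + r + p + q"

abbreviation F :: "nat \<Rightarrow> 'a measure" where "F t \<equiv> past M r X Y (int t - 1)"

abbreviation \<eta> :: "nat \<Rightarrow> 'a \<Rightarrow> real vec \<Rightarrow> real" where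
  "\<eta> t \<omega> v \<equiv> eta g r p q X Y v t \<omega>"

abbreviation \<mu> :: "nat \<Rightarrow> 'a \<Rightarrow> real" where "\<mu> t \<omega> \<equiv> mu g r p q X Y \<gamma> t \<omega>"

lemma eta_rpoly_past: "\<eta> t \<in> rpoly (F t) N"
  using eta_rpoly[of t r X "F t" Y p q] Y_range
  by (simp add: measurable_past_X measurable_past_Y space_past)

lemma mu_range: "0 < \<mu> t \<omega>" "\<mu> t \<omega> < 1"
  by (simp_all add: mu_def h_range)

lemma mu_measurable: "\<mu> t \<in> borel_measurable (F t)"
  unfolding mu_def using rpoly_measurable[OF eta_rpoly_past] by measurable

text \<open>On functions affine in the odds both notions of conditional expectation take the same
  value: here at every \<open>\<omega>\<close>, in \<open>abs_cond_exp_affine_odds\<close> almost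
  surely.\<close>

lemma law_cond_exp_affine_odds:
  "law_cond_exp g r p q X Y \<gamma> t (\<lambda>\<omega> y. c0 \<omega> + c1 \<omega> * (y / (1 - y))) \<omega>
    = c0 \<omega> + c1 \<omega> * UL_odds_mean (\<mu> t \<omega>)"
  unfolding law_cond_exp_def by (rule UL_affine_odds(2)[OF mu_range])

lemma abs_cond_exp_affine_odds:
  assumes t: "1 \<le> t" and c: "c0 \<in> borel_measurable (F t)" "c1 \<in> borel_measurable (F t)"
  shows "AE \<omega> in M. abs_cond_exp M r X Y t (\<lambda>\<omega> y. c0 \<omega> + c1 \<omega> * (y / (1 - y))) \<omega>
    = c0 \<omega> + c1 \<omega> * UL_odds_mean (\<mu> t \<omega>)"
proof -
  have "subalgebra M (F t)"
    by (rule subalgebra_past) (simp_all add: X_meas Y_meas)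
  then interpret S: finite_measure_subalgebra M "F t"
    by unfold_locales
  show ?thesis
    unfolding abs_cond_exp_def
    by (rule S.real_cond_exp_UL_affine_odds)
       (use cond_law[OF t] c mu_range mu_measurable Y_meas in \<open>auto intro: finite_measure_axioms\<close>)
qed

abbreviation curvature :: "nat \<Rightarrow> 'a \<Rightarrow> real \<Rightarrow> real" where
  "curvature t \<equiv> \<lambda>\<omega> y. (deriv ^^ 2) (\<lambda>m. UL_loglik m y) (\<mu> t \<omega>)"

lemma curvature_affine_odds:
  "curvature t = (\<lambda>\<omega> y. - 2 / (1 - \<mu> t \<omega>)\<^sup>2 + 1 / (\<mu> t \<omega>)\<^sup>2 + - (2 / \<mu> t \<omega> ^ 3) * (y / (1 - y)))"
  by (simp only: deriv2_UL_loglik[OF mu_range] UL_curv_affine_odds)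

lemma curvature_mean:
  "- 2 / (1 - \<mu> t \<omega>)\<^sup>2 + 1 / (\<mu> t \<omega>)\<^sup>2 + - (2 / \<mu> t \<omega> ^ 3) * UL_odds_mean (\<mu> t \<omega>)
    = - UL_info (\<mu> t \<omega>)"
  using UL_curv_mean[OF mu_range, of t \<omega>] by (simp add: UL_info_def)

lemma law_cond_exp_curvature:
  "law_cond_exp g r p q X Y \<gamma> t (curvature t) \<omega> = - UL_info (\<mu> t \<omega>)"
  unfolding curvature_affine_odds law_cond_exp_affine_odds by (rule curvature_mean)

lemma abs_cond_exp_curvature:
  assumes "1 \<le> t"
  shows "AE \<omega> in M. abs_cond_exp M r X Y t (curvature t) \<omega> = - UL_info (\<mu> t \<omega>)"
proof -
  note [measurable] = mu_measurable[of t]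
  show ?thesis
    unfolding curvature_affine_odds curvature_mean[symmetric]
    by (rule abs_cond_exp_affine_odds[OF assms]) measurable
qed

abbreviation hessian :: "nat \<Rightarrow> nat \<Rightarrow> nat \<Rightarrow> 'a \<Rightarrow> real \<Rightarrow> real" where
  "hessian t i j \<equiv> \<lambda>\<omega> y.
     partial_deriv i (partial_deriv j (\<lambda>\<gamma>. loglik_term g r p q X Y \<gamma> t \<omega> y)) \<gamma>"

text \<open>The summand of time \<open>t\<close> in entry \<open>(i, j)\<close> of
  \<open>D' T E T D\<close>.\<close>

definition information :: "nat \<Rightarrow> nat \<Rightarrow> nat \<Rightarrow> 'a \<Rightarrow> real" where
  "information t i j \<omega> = UL_info (\<mu> t \<omega>) * (1 / deriv g (\<mu> t \<omega>))\<^sup>2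
     * partial_deriv i (\<eta> t \<omega>) \<gamma> * partial_deriv j (\<eta> t \<omega>) \<gamma>"

text \<open>The case of the predictor itself: since \<open>\<mu> t\<close> is \<open>h\<close> of
  the predictor, \<open>h'\<close> there is \<open>1 / deriv g (\<mu> t \<omega>)\<close>.\<close>

lemma hessian_obtain:
  assumes "i < N" "j < N"
  obtains c0 c1 where "c0 \<in> borel_measurable (F t)" "c1 \<in> borel_measurable (F t)"
    "hessian t i j = (\<lambda>\<omega> y. c0 \<omega> + c1 \<omega> * (y / (1 - y)))"
    "\<And>\<omega>. c0 \<omega> + c1 \<omega> * UL_odds_mean (\<mu> t \<omega>) = - information t i j \<omega>"
  using hessian_affine_odds[OF eta_rpoly_past[of t] assms par_dim]
  by (auto simp add: information_def loglik_term_def mu_def h'_def fun_eq_iff)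

lemma law_cond_exp_hessian:
  assumes "i < N" "j < N"
  shows "law_cond_exp g r p q X Y \<gamma> t (hessian t i j) \<omega> = - information t i j \<omega>"
proof -
  obtain c0 c1 where "c0 \<in> borel_measurable (F t)" "c1 \<in> borel_measurable (F t)"
    and c: "hessian t i j = (\<lambda>\<omega> y. c0 \<omega> + c1 \<omega> * (y / (1 - y)))"
      "\<And>\<omega>. c0 \<omega> + c1 \<omega> * UL_odds_mean (\<mu> t \<omega>) = - information t i j \<omega>"
    using hessian_obtain[OF assms, of t] by blast
  show ?thesis
    unfolding c(1) law_cond_exp_affine_odds by (rule c(2))
qed

lemma abs_cond_exp_hessian:
  assumes "1 \<le> t" "i < N" "j < N"
  shows "AE \<omega> in M. abs_cond_exp M r X Y t (hessian t i j) \<omega> = - information t i j \<omega>"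
proof -
  obtain c0 c1 where
    m: "c0 \<in> borel_measurable (F t)" "c1 \<in> borel_measurable (F t)"
    and c: "hessian t i j = (\<lambda>\<omega> y. c0 \<omega> + c1 \<omega> * (y / (1 - y)))"
      "\<And>\<omega>. c0 \<omega> + c1 \<omega> * UL_odds_mean (\<mu> t \<omega>) = - information t i j \<omega>"
    using hessian_obtain[OF assms(2,3), of t] by blast
  show ?thesis
    unfolding c(1) c(2)[symmetric] by (rule abs_cond_exp_affine_odds[OF assms(1) m])
qed

section \<open>Assembling the matrix identity\<close>

lemma E_matrix_diag:
  "k < n \<Longrightarrow> E_matrix g r p q X Y \<gamma> n \<omega> $$ (k, k) = UL_info (\<mu> (Suc k) \<omega>)"
  by (simp add: E_matrix_def mat_diag_def UL_info_def Let_def)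

text \<open>Abstract in the operator \<open>E\<close>, so that one computation serves both notions
  of conditional expectation.\<close>

lemma cond_info_matrix_eq:
  assumes "\<And>t i j. 1 \<le> t \<Longrightarrow> i < N \<Longrightarrow> j < N \<Longrightarrow> E t (hessian t i j) \<omega> = - information t i j \<omega>"
  shows "cond_info_matrix E g r p q X Y \<gamma> n \<omega> =
    transpose_mat (D_matrix g r p q X Y \<gamma> n \<omega>) * T_matrix g r p q X Y \<gamma> n \<omega>
      * E_matrix g r p q X Y \<gamma> n \<omega> * T_matrix g r p q X Y \<gamma> n \<omega>
      * D_matrix g r p q X Y \<gamma> n \<omega>"
    (is "_ = transpose_mat ?D * ?T * ?E * ?T * ?D")
proof (rule eq_matI)
  define w where "w k = (1 / deriv g (\<mu> (Suc k) \<omega>)) * UL_info (\<mu> (Suc k) \<omega>) * (1 / deriv g (\<mu> (Suc k) \<omega>))" for k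
  have D: "?D \<in> carrier_mat n N" by (simp add: D_matrix_def)
  then have Dt: "transpose_mat ?D \<in> carrier_mat N n" by simp
  \<comment> \<open>Diagonal matrices multiply entrywise, so the whole product becomes a weighted
    sum over the rows of \<open>?D\<close>.\<close>
  have "?T * ?E * ?T = mat_diag n w"
    by (simp add: T_matrix_def E_matrix_def w_def[abs_def] UL_info_def Let_def)
  moreover have "?T \<in> carrier_mat n n" "?E \<in> carrier_mat n n"
    by (simp_all add: T_matrix_def E_matrix_def)
  ultimately have TET: "transpose_mat ?D * ?T * ?E * ?T = transpose_mat ?D * mat_diag n w"
    using Dt by (simp add: assoc_mult_mat[of _ N n _ n _ n] flip: \<open>?T * ?E * ?T = mat_diag n w\<close>)
  show "dim_row (cond_info_matrix E g r p q X Y \<gamma> n \<omega>) = dim_row (transpose_mat ?D * ?T * ?E * ?T * ?D)"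
    "dim_col (cond_info_matrix E g r p q X Y \<gamma> n \<omega>) = dim_col (transpose_mat ?D * ?T * ?E * ?T * ?D)"
    using D by (simp_all add: cond_info_matrix_def)
  fix i j
  assume "i < dim_row (transpose_mat ?D * ?T * ?E * ?T * ?D)"
    "j < dim_col (transpose_mat ?D * ?T * ?E * ?T * ?D)"
  with D have ij: "i < N" "j < N" by simp_all
  have "cond_info_matrix E g r p q X Y \<gamma> n \<omega> $$ (i, j) = (\<Sum>t = 1..n. information t i j \<omega>)"
    using ij by (simp add: cond_info_matrix_def assms sum_negf)
  \<comment> \<open>Times run from 1 and rows from 0, so row \<open>k\<close> belongs to time
    \<open>Suc k\<close>.\<close>
  also have "\<dots> = (\<Sum>k = 0..<n. information (Suc k) i j \<omega>)"
    by (rule sum.reindex_bij_witness[of _ Suc "\<lambda>t. t - 1"]) auto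
  also have "\<dots> = (\<Sum>k = 0..<n. ?D $$ (k, i) * w k * ?D $$ (k, j))"
    using ij by (intro sum.cong) (simp_all add: information_def w_def D_matrix_def power2_eq_square mult_ac)
  also have "\<dots> = (transpose_mat ?D * ?T * ?E * ?T * ?D) $$ (i, j)"
    using ij D unfolding TET mat_diag_mult_right[OF Dt]
    by (simp add: scalar_prod_def)
  finally show "cond_info_matrix E g r p q X Y \<gamma> n \<omega> $$ (i, j)
    = (transpose_mat ?D * ?T * ?E * ?T * ?D) $$ (i, j)" .
qed

end

theorem mainTheorem1:
  fixes M :: "'a measure" and g :: "real \<Rightarrow> real" and r p q n :: nat
    and X :: "int \<Rightarrow> 'a \<Rightarrow> real vec" and Y :: "int \<Rightarrow> 'a \<Rightarrow> real"
    and \<gamma> :: "real vec" and \<Omega> :: "real vec set"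
  assumes "n \<ge> 1"
    and "\<Omega> \<subseteq> carrier_vec (1 + r + p + q)"
    and "\<gamma> \<in> \<Omega>"
    and "ularma M g r p q X Y \<gamma>"
  shows
    "(\<forall>\<omega>\<in>space M.
        (\<forall>k<n. E_matrix g r p q X Y \<gamma> n \<omega> $$ (k, k) =
           - law_cond_exp g r p q X Y \<gamma> (Suc k)
               (\<lambda>\<omega> y. (deriv ^^ 2) (\<lambda>m. UL_loglik m y) (mu g r p q X Y \<gamma> (Suc k) \<omega>)) \<omega>) \<and>
        cond_info_matrix (law_cond_exp g r p q X Y \<gamma>) g r p q X Y \<gamma> n \<omega> =
          transpose_mat (D_matrix g r p q X Y \<gamma> n \<omega>) * T_matrix g r p q X Y \<gamma> n \<omega>
            * E_matrix g r p q X Y \<gamma> n \<omega> * T_matrix g r p q X Y \<gamma> n \<omega>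
            * D_matrix g r p q X Y \<gamma> n \<omega>) \<and>
     (AE \<omega> in M.
        (\<forall>k<n. E_matrix g r p q X Y \<gamma> n \<omega> $$ (k, k) =
           - abs_cond_exp M r X Y (Suc k)
               (\<lambda>\<omega> y. (deriv ^^ 2) (\<lambda>m. UL_loglik m y) (mu g r p q X Y \<gamma> (Suc k) \<omega>)) \<omega>) \<and>
        cond_info_matrix (abs_cond_exp M r X Y) g r p q X Y \<gamma> n \<omega> =
          transpose_mat (D_matrix g r p q X Y \<gamma> n \<omega>) * T_matrix g r p q X Y \<gamma> n \<omega>
            * E_matrix g r p q X Y \<gamma> n \<omega> * T_matrix g r p q X Y \<gamma> n \<omega>
            * D_matrix g r p q X Y \<gamma> n \<omega>)"
proof -
  interpret ularma M g r p q X Y \<gamma> by fact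
  \<comment> \<open>There are countably many triples \<open>(t, i, j)\<close>, so one null set
    serves all entries at once.\<close>
  have "AE \<omega> in M. \<forall>t i j. 1 \<le> t \<longrightarrow> i < N \<longrightarrow> j < N \<longrightarrow>
      abs_cond_exp M r X Y t (hessian t i j) \<omega> = - information t i j \<omega>"
    by (intro AE_all_countable[THEN iffD2] allI AE_impI abs_cond_exp_hessian)
  moreover have "AE \<omega> in M. \<forall>k. abs_cond_exp M r X Y (Suc k) (curvature (Suc k)) \<omega>
      = - UL_info (\<mu> (Suc k) \<omega>)"
    by (intro AE_all_countable[THEN iffD2] allI abs_cond_exp_curvature) simp
  ultimately have "AE \<omega> in M.
      (\<forall>k<n. E_matrix g r p q X Y \<gamma> n \<omega> $$ (k, k) =
         - abs_cond_exp M r X Y (Suc k) (curvature (Suc k)) \<omega>) \<and>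
      cond_info_matrix (abs_cond_exp M r X Y) g r p q X Y \<gamma> n \<omega> =
        transpose_mat (D_matrix g r p q X Y \<gamma> n \<omega>) * T_matrix g r p q X Y \<gamma> n \<omega>
          * E_matrix g r p q X Y \<gamma> n \<omega> * T_matrix g r p q X Y \<gamma> n \<omega>
          * D_matrix g r p q X Y \<gamma> n \<omega>"
  proof eventually_elim
    case (elim \<omega>)
    show ?case
    proof (intro conjI allI impI)
      show "E_matrix g r p q X Y \<gamma> n \<omega> $$ (k, k) =
          - abs_cond_exp M r X Y (Suc k) (curvature (Suc k)) \<omega>" if "k < n" for k
        unfolding E_matrix_diag[OF that] using elim(2) by (simp only: minus_minus)
    qed (rule cond_info_matrix_eq, use elim(1) in blast)
  qed
  moreover have "\<forall>\<omega>\<in>space M.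
      (\<forall>k<n. E_matrix g r p q X Y \<gamma> n \<omega> $$ (k, k) =
         - law_cond_exp g r p q X Y \<gamma> (Suc k) (curvature (Suc k)) \<omega>) \<and>
      cond_info_matrix (law_cond_exp g r p q X Y \<gamma>) g r p q X Y \<gamma> n \<omega> =
        transpose_mat (D_matrix g r p q X Y \<gamma> n \<omega>) * T_matrix g r p q X Y \<gamma> n \<omega>
          * E_matrix g r p q X Y \<gamma> n \<omega> * T_matrix g r p q X Y \<gamma> n \<omega>
          * D_matrix g r p q X Y \<gamma> n \<omega>"
  proof (intro ballI conjI allI impI)
    fix \<omega>
    show "E_matrix g r p q X Y \<gamma> n \<omega> $$ (k, k) =
        - law_cond_exp g r p q X Y \<gamma> (Suc k) (curvature (Suc k)) \<omega>" if "k < n" for k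
      unfolding E_matrix_diag[OF that] law_cond_exp_curvature by (simp only: minus_minus)
  qed (rule cond_info_matrix_eq, rule law_cond_exp_hessian)
  ultimately show ?thesis by (rule conjI[rotated])
qed

end
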